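(* Let $A$ be a real $m\times n$ matrix with full rank and let $\nu^{\mathrm{strict}}\in\mathbb{R}^m$. If $\nu^{\mathrm{strict}}$ is strictly dual feasible (i.e., $A^T\nu^{\mathrm{strict}}>0$ componentwise), then the dual line search mapping $\nu'\mapsto\hat{\nu}$ from $\mathbb{R}^m$ to $\mathbb{R}^m$, defined by $\hat{\nu}=(1-t^\ast)\nu'+t^\ast\nu^{\mathrm{strict}}$ where $t^\ast=t^\ast(\nu')$ is the optimal value of $$\min\ t\quad\text{s.t.}\quad A^T\big((1-t)\nu'+t\nu^{\mathrm{strict}}\big)\ge 0,\quad 0\le t\le 1,$$ is continuous in $\nu'$.
   Context: Vector inequalities are componentwise. A point $\nu\in\mathbb{R}^m$ is called dual feasible if $A^T\nu\ge 0$ and strictly dual feasible if $A^T\nu>0$. *)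

theory Defs
  imports "HOL-Analysis.Analysis"
begin

(* An m x n matrix has type real^'n^'m. The library order on real^'n is componentwise for
   (\<le>), but (<) is merely the strict part of (\<le>), so the strict componentwise
   inequality has to be written out. *)

definition full_rank :: "real^'n^'m \<Rightarrow> bool" where
  "full_rank A \<longleftrightarrow> rank A = min CARD('m) CARD('n)"

definition dual_feasible :: "real^'n^'m \<Rightarrow> real^'m \<Rightarrow> bool" where
  "dual_feasible A \<nu> \<longleftrightarrow> (\<forall>j. (transpose A *v \<nu>) $ j \<ge> 0)"

definition strictly_dual_feasible :: "real^'n^'m \<Rightarrow> real^'m \<Rightarrow> bool" where
  "strictly_dual_feasible A \<nu> \<longleftrightarrow> (\<forall>j. (transpose A *v \<nu>) $ j > 0)"

definition line_search_feasible_set :: "real^'n^'m \<Rightarrow> real^'m \<Rightarrow> real^'m \<Rightarrow> real set" where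
  "line_search_feasible_set A \<nu>s \<nu>' =
     {t. dual_feasible A ((1 - t) *\<^sub>R \<nu>' + t *\<^sub>R \<nu>s) \<and> 0 \<le> t \<and> t \<le> 1}"

(* Optimal value of the line search problem. The feasible set is bounded below by 0 and
   contains 1 whenever \<nu>s is dual feasible, so Inf is then the genuine infimum. *)
definition line_search_opt :: "real^'n^'m \<Rightarrow> real^'m \<Rightarrow> real^'m \<Rightarrow> real" where
  "line_search_opt A \<nu>s \<nu>' = Inf (line_search_feasible_set A \<nu>s \<nu>')"

definition dual_line_search :: "real^'n^'m \<Rightarrow> real^'m \<Rightarrow> real^'m \<Rightarrow> real^'m" where
  "dual_line_search A \<nu>s \<nu>' =
     (1 - line_search_opt A \<nu>s \<nu>') *\<^sub>R \<nu>' + line_search_opt A \<nu>s \<nu>' *\<^sub>R \<nu>s"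

end

theory Submission
  imports Defs
begin

text \<open>
  Put \<open>a = A\<^sup>T \<nu>'\<close> and \<open>s = A\<^sup>T \<nu>s\<close>, where every \<open>s\<^sub>j\<close> is positive. The constraints of the line
  search decouple by coordinate: on \<open>[0, 1]\<close> the \<open>j\<close>-th one, \<open>(1 - t) a\<^sub>j + t s\<^sub>j \<ge> 0\<close>, is just a
  lower bound on \<open>t\<close>, namely \<open>p / (s\<^sub>j + p) \<le> t\<close> where \<open>p = max 0 (- a\<^sub>j)\<close> is the negative part of
  \<open>a\<^sub>j\<close>. So the feasible set is the interval from the largest of these bounds to \<open>1\<close>
  (\<open>line_search_feasible_set_eq_interval\<close>), and the optimal value is that maximum.
  The denominators never vanish because \<open>s\<^sub>j > 0\<close>; hence every bound is continuous in \<open>\<nu>'\<close>, and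
  so are their finite maximum and the resulting convex combination.
\<close>

text \<open>
  The negative part removes the case distinction on the sign of \<open>a\<close>. For \<open>a \<ge> 0\<close> the bound is \<open>0\<close>
  and every \<open>t\<close> in \<open>[0, 1]\<close> satisfies the constraint; for \<open>a < 0\<close> it is \<open>- a / (s - a)\<close>, the point where the
  segment from \<open>a\<close> to \<open>s\<close> crosses zero.
\<close>

definition min_step :: "real \<Rightarrow> real \<Rightarrow> real" where
  "min_step s a = max 0 (- a) / (s + max 0 (- a))"

lemma min_step_bounds:
  assumes "s > 0"
  shows "0 \<le> min_step s a" "min_step s a \<le> 1"
  using assms by (auto simp: min_step_def divide_simps)

lemma segment_nonneg_iff_min_step_le:
  assumes "s > 0" "0 \<le> t" "t \<le> 1"
  shows "(1 - t) * a + t * s \<ge> 0 \<longleftrightarrow> min_step s a \<le> t"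
proof (cases "a \<ge> 0")
  case True
  then show ?thesis using assms by (simp add: min_step_def)
next
  case False
  then have "s - a > 0" using assms by simp
  moreover have "min_step s a = (- a) / (s - a)"
    using False by (simp add: min_step_def)
  ultimately have "min_step s a \<le> t \<longleftrightarrow> - a \<le> t * (s - a)"
    by (simp only: pos_divide_le_eq)
  then show ?thesis by (simp add: algebra_simps)
qed

lemma continuous_on_Max_finite:
  fixes f :: "'i \<Rightarrow> 'a::topological_space \<Rightarrow> 'b::linorder_topology"
  assumes "finite I" "I \<noteq> {}" "\<And>i. i \<in> I \<Longrightarrow> continuous_on S (f i)"
  shows "continuous_on S (\<lambda>x. MAX i\<in>I. f i x)"
  using assms
  by (induction rule: finite_ne_induct) (auto intro!: continuous_on_max)

lemma line_search_feasible_set_eq_interval: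
  fixes A :: "real^'n^'m"
  assumes "strictly_dual_feasible A \<nu>s"
  shows "line_search_feasible_set A \<nu>s \<nu>' =
    {(MAX j. min_step ((transpose A *v \<nu>s) $ j) ((transpose A *v \<nu>') $ j)) .. 1}"
    (is "_ = {Max (range ?m) .. 1}")
proof (intro set_eqI)
  fix t
  have s: "(transpose A *v \<nu>s) $ j > 0" for j
    using assms by (simp add: strictly_dual_feasible_def)
  have le: "Max (range ?m) \<le> t \<longleftrightarrow> (\<forall>j. ?m j \<le> t)"
    by simp
  have nonneg: "0 \<le> t" if "\<forall>j. ?m j \<le> t"
    using that min_step_bounds(1)[OF s] order_trans by blast
  have affine: "(transpose A *v ((1 - t) *\<^sub>R \<nu>' + t *\<^sub>R \<nu>s)) $ j =
      (1 - t) * (transpose A *v \<nu>') $ j + t * (transpose A *v \<nu>s) $ j" for j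
    by (simp only: matrix_vector_right_distrib matrix_vector_mult_scaleR
        vector_add_component vector_scaleR_component real_scaleR_def)
  show "t \<in> line_search_feasible_set A \<nu>s \<nu>' \<longleftrightarrow> t \<in> {Max (range ?m) .. 1}"
    unfolding line_search_feasible_set_def dual_feasible_def mem_Collect_eq affine
      atLeastAtMost_iff le
    using nonneg segment_nonneg_iff_min_step_le[OF s] by blast
qed

lemma line_search_opt_eq_Max:
  fixes A :: "real^'n^'m"
  assumes "strictly_dual_feasible A \<nu>s"
  shows "line_search_opt A \<nu>s \<nu>' =
    (MAX j. min_step ((transpose A *v \<nu>s) $ j) ((transpose A *v \<nu>') $ j))"
proof -
  have "(MAX j. min_step ((transpose A *v \<nu>s) $ j) ((transpose A *v \<nu>') $ j)) \<le> 1"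
    using assms by (simp add: strictly_dual_feasible_def min_step_bounds)
  then show ?thesis
    unfolding line_search_opt_def line_search_feasible_set_eq_interval[OF assms]
    by (rule cInf_atLeastAtMost)
qed

lemma continuous_on_line_search_opt:
  fixes A :: "real^'n^'m"
  assumes "strictly_dual_feasible A \<nu>s"
  shows "continuous_on UNIV (line_search_opt A \<nu>s)"
proof -
  have nonzero: "(transpose A *v \<nu>s) $ j + max 0 x \<noteq> 0" for j and x :: real
    using assms by (auto simp: strictly_dual_feasible_def
      intro!: less_imp_neq[symmetric] add_pos_nonneg)
  have "continuous_on UNIV
      (\<lambda>\<nu>'. MAX j. min_step ((transpose A *v \<nu>s) $ j) ((transpose A *v \<nu>') $ j))"
    unfolding min_step_def using nonzero
    by (intro continuous_on_Max_finite continuous_intros matrix_vector_mult_linear_continuous_on) auto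
  then show ?thesis
    by (simp add: line_search_opt_eq_Max[OF assms, abs_def])
qed

theorem lemma4p1:
  fixes A :: "real^'n^'m" and \<nu>s :: "real^'m"
  assumes "full_rank A"
    and "strictly_dual_feasible A \<nu>s"
  shows "continuous_on UNIV (dual_line_search A \<nu>s)"
  unfolding dual_line_search_def[abs_def]
  by (intro continuous_intros continuous_on_line_search_opt assms(2))

end
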